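(* Let $G$ be a generalized group. Then $(a^{-1})^{-1}=a$ for all $a\in G$.
   Context: A generalized group is a non-empty set $G$ with a binary operation (written multiplicatively) such that: (i) $(xy)z=x(yz)$ for all $x,y,z\in G$; (ii) for each $x\in G$ there exists a unique element $e(x)\in G$ such that $xe(x)=e(x)x=x$; (iii) for each $x\in G$ there exists $x^{-1}\in G$ such that $xx^{-1}=x^{-1}x=e(x)$. In a generalized group, the element $x^{-1}$ in (iii) is unique for each $x$, so $x\mapsto x^{-1}$ is a well-defined map. *)

theory Defs
  imports Main
begin

definition gg_id :: "'a set \<Rightarrow> ('a \<Rightarrow> 'a \<Rightarrow> 'a) \<Rightarrow> 'a \<Rightarrow> 'a" where
  "gg_id G m x = (THE e. e \<in> G \<and> m x e = x \<and> m e x = x)"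

definition gg_inv :: "'a set \<Rightarrow> ('a \<Rightarrow> 'a \<Rightarrow> 'a) \<Rightarrow> 'a \<Rightarrow> 'a" where
  "gg_inv G m x = (THE y. y \<in> G \<and> m x y = gg_id G m x \<and> m y x = gg_id G m x)"

locale generalized_group =
  fixes G :: "'a set" and m :: "'a \<Rightarrow> 'a \<Rightarrow> 'a" (infixl \<open>\<cdot>\<close> 70)
  assumes nonempty: "G \<noteq> {}"
    and closed: "\<And>x y. x \<in> G \<Longrightarrow> y \<in> G \<Longrightarrow> x \<cdot> y \<in> G"
    and assoc: "\<And>x y z. x \<in> G \<Longrightarrow> y \<in> G \<Longrightarrow> z \<in> G \<Longrightarrow> (x \<cdot> y) \<cdot> z = x \<cdot> (y \<cdot> z)"
    and ex1_id: "\<And>x. x \<in> G \<Longrightarrow> \<exists>!e. e \<in> G \<and> x \<cdot> e = x \<and> e \<cdot> x = x"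
    and ex_inv: "\<And>x. x \<in> G \<Longrightarrow> \<exists>y\<in>G. x \<cdot> y = gg_id G m x \<and> y \<cdot> x = gg_id G m x"
begin

lemma gg_id: 
  assumes "x \<in> G"
  shows "gg_id G m x \<in> G" "x \<cdot> gg_id G m x = x" "gg_id G m x \<cdot> x = x"
  using theI'[OF ex1_id[OF assms]] unfolding gg_id_def by blast+

text \<open>The descriptions in \<^const>\<open>gg_id\<close> and \<^const>\<open>gg_inv\<close> are well defined: the former by
  the axiom \<open>ex1_id\<close>, the latter by the following lemma.\<close>

lemma ex1_inv:
  assumes x: "x \<in> G"
  shows "\<exists>!y. y \<in> G \<and> x \<cdot> y = gg_id G m x \<and> y \<cdot> x = gg_id G m x"
proof -
  let ?e = "gg_id G m x"
  have e: "?e \<in> G" "x \<cdot> ?e = x" "?e \<cdot> x = x"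
    using gg_id x by auto
  have ee: "?e \<cdot> ?e = ?e"
    using ex1_id[OF x] e assoc closed x by metis
  have absorb: "?e \<cdot> y = y \<and> y \<cdot> ?e = y"
    if y: "y \<in> G" and xy: "x \<cdot> y = ?e" and yx: "y \<cdot> x = ?e" for y
  proof -
    let ?f = "gg_id G m y" and ?z = "?e \<cdot> y"
    have f: "?f \<in> G" "y \<cdot> ?f = y" "?f \<cdot> y = y"
      using gg_id y by auto
    have z: "?z \<in> G" "?z = y \<cdot> ?e"
      using closed e y assoc[OF y x y] xy yx by auto
    have "?z \<cdot> ?f = ?z" "?f \<cdot> ?z = ?z" "?e \<cdot> ?z = ?z" "?z \<cdot> ?e = ?z"
      using assoc e f y z ee by metis+
    then have "?e = ?f"
      using ex1_id[OF z(1)] e(1) f(1) by blast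
    then show ?thesis
      using f by simp
  qed
  have "y = y'"
    if "y \<in> G" "x \<cdot> y = ?e" "y \<cdot> x = ?e" "y' \<in> G" "x \<cdot> y' = ?e" "y' \<cdot> x = ?e" for y y'
    using absorb that assoc x by metis
  then show ?thesis
    using ex_inv[OF x] by blast
qed

end

end

theory Submission
  imports Defs
begin

context generalized_group
begin

lemma gg_inv:
  assumes "x \<in> G"
  shows "gg_inv G m x \<in> G" "x \<cdot> gg_inv G m x = gg_id G m x" "gg_inv G m x \<cdot> x = gg_id G m x"
  using theI'[OF ex1_inv[OF assms]] unfolding gg_inv_def by blast+

lemma gg_id_eqI:
  assumes "x \<in> G" "e \<in> G" "x \<cdot> e = x" "e \<cdot> x = x"
  shows "gg_id G m x = e"
  using ex1_id[OF assms(1)] gg_id[OF assms(1)] assms by blast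

lemma gg_inv_eqI:
  assumes "x \<in> G" "y \<in> G" "x \<cdot> y = gg_id G m x" "y \<cdot> x = gg_id G m x"
  shows "gg_inv G m x = y"
  using ex1_inv[OF assms(1)] gg_inv[OF assms(1)] assms by blast

text \<open>By associativity, the square of the identity of \<open>x\<close> also fixes
  \<open>x\<close> from both sides, so uniqueness of that identity makes the two equal.\<close>

lemma gg_id_idem:
  assumes x: "x \<in> G"
  shows "gg_id G m x \<cdot> gg_id G m x = gg_id G m x"
proof -
  let ?e = "gg_id G m x"
  have "x \<cdot> (?e \<cdot> ?e) = x" "(?e \<cdot> ?e) \<cdot> x = x"
    using gg_id[OF x] assoc[OF x, of ?e ?e] assoc[of ?e ?e x] x by simp_all
  then show ?thesis
    using gg_id_eqI[OF x, of "?e \<cdot> ?e"] closed gg_id(1)[OF x] by simp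
qed

text \<open>With \<open>e\<close> the identity and \<open>b\<close> the inverse of \<open>x\<close>, the product \<open>e b\<close> is again an inverse
  of \<open>x\<close>, hence equals \<open>b\<close>; so \<open>e\<close> acts as an identity on \<open>b\<close>.\<close>

lemma gg_id_gg_inv:
  assumes x: "x \<in> G"
  shows "gg_id G m (gg_inv G m x) = gg_id G m x"
proof -
  let ?e = "gg_id G m x" and ?b = "gg_inv G m x"
  note e = gg_id[OF x] and b = gg_inv[OF x]
  have "x \<cdot> (?e \<cdot> ?b) = ?e"
    using assoc[OF x e(1) b(1)] e(2) b(2) by simp
  \<comment> \<open>Reassociating leaves \<open>?e \<cdot> ?e\<close>, which is where idempotence
    enters.\<close>
  moreover have "(?e \<cdot> ?b) \<cdot> x = ?e"
    using assoc[OF e(1) b(1) x] b(3) gg_id_idem[OF x] by simp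
  ultimately have eb: "?e \<cdot> ?b = ?b"
    using gg_inv_eqI[OF x closed[OF e(1) b(1)]] by simp
  \<comment> \<open>Both sides are bracketings of \<open>?b \<cdot> x \<cdot> ?b\<close>, as
    \<open>?e\<close> is both \<open>x \<cdot> ?b\<close> and \<open>?b \<cdot> x\<close>.\<close>
  have "?b \<cdot> ?e = ?e \<cdot> ?b"
    using assoc[OF b(1) x b(1)] b by simp
  with eb show ?thesis
    using gg_id_eqI[OF b(1) e(1)] by simp
qed

text \<open>Since \<open>x\<close> and its inverse share one identity, the inverse equations are
  symmetric in the two; uniqueness of inverses concludes.\<close>

lemma gg_inv_gg_inv:
  assumes x: "x \<in> G"
  shows "gg_inv G m (gg_inv G m x) = x"
  using gg_inv_eqI[OF gg_inv(1)[OF x] x] gg_inv[OF x] gg_id_gg_inv[OF x] by simp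

end

theorem theorem3p1:
  fixes G :: "'a set" and m :: "'a \<Rightarrow> 'a \<Rightarrow> 'a"
  assumes "generalized_group G m"
  shows "\<forall>a\<in>G. gg_inv G m (gg_inv G m a) = a"
  using generalized_group.gg_inv_gg_inv[OF assms] by blast

end
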